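(* Let $n\ge3$ and let $K$ be a finite field with $q$ elements. Then \[ |C_3(n)|=\begin{cases}q^{2n}-q^{n+2}-q^{n+1}+q^3,& n\not\equiv0\pmod 3,\\ q^{2n}+2q^{n+2}+2q^{n+1}+q^3,& n\equiv0\pmod3.\end{cases} \]
   Context: $C_3(n)$ is the set of tuples $(v_1,\dots,v_n)\in(\mathbb{P}^2(K))^n$ such that for every $i\in\{1,\dots,n\}$ the points $v_i,v_{i+1},v_{i+2}$ (indices mod $n$) are projectively independent, i.e. their lifts in $K^3$ are linearly independent. *)

theory Defs
  imports "HOL-Analysis.Cartesian_Space" "HOL-Number_Theory.Cong"
begin

definition proj_plane :: "('a::field ^ 3) set set" where
  "proj_plane = {L. vec.subspace L \<and> vec.dim L = 1}"

definition lifts :: "('a::field ^ 3) set \<Rightarrow> ('a ^ 3) set" where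
  "lifts p = p - {0}"

text \<open>Linear independence is meant for the family \<open>x, y, z\<close>, whereas
  \<^const>\<open>vec.independent\<close> is a predicate on sets; hence the distinctness condition.\<close>

definition proj_indep :: "('a::field ^ 3) set \<Rightarrow> ('a ^ 3) set \<Rightarrow> ('a ^ 3) set \<Rightarrow> bool" where
  "proj_indep p q r \<longleftrightarrow>
     (\<forall>x\<in>lifts p. \<forall>y\<in>lifts q. \<forall>z\<in>lifts r.
        distinct [x, y, z] \<and> vec.independent {x, y, z})"

definition C3 :: "nat \<Rightarrow> ('a::field ^ 3) set list set" where
  "C3 n = {vs. length vs = n \<and> set vs \<subseteq> proj_plane \<and>
     (\<forall>i<n. proj_indep (vs ! i) (vs ! ((i + 1) mod n)) (vs ! ((i + 2) mod n)))}"

end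

theory Submission
  imports Defs
begin

text \<open>
  The result holds in every finite projective plane of order \<open>q\<close>. A cyclic tuple is a closed walk of
  pairs \<open>(v\<^sub>i, v\<^sub>i\<^sub>+\<^sub>1)\<close>, where a step picks a point off the line spanned by the current pair. Recording
  only the flag formed by \<open>v\<^sub>i\<close> and the line \<open>v\<^sub>iv\<^sub>i\<^sub>+\<^sub>1\<close>, a step becomes multiplication by the Coxeter
  element \<open>T\<^sub>1T\<^sub>2\<close> of the Hecke algebra of \<open>S\<^sub>3\<close>: the number of walks from a fixed flag depends only
  on which of the six Bruhat cells the final flag lies in, and these six numbers evolve linearly.
  The eigenvalues of \<open>T\<^sub>1T\<^sub>2\<close> are \<open>q\<^sup>2\<close>, \<open>1\<close> and \<open>q\<omega>\<close>, \<open>q\<omega>\<^sup>2\<close> for a primitive cube root of unity \<open>\<omega>\<close>,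
  whence the dependence on \<open>n\<close> modulo 3. The count is the number of flags
  \<open>(q + 1)(q\<^sup>2 + q + 1)\<close> times the coefficient of the identity cell in \<open>(T\<^sub>1T\<^sub>2)\<^sup>n\<close>.
\<close>

section \<open>Closed walks of triples\<close>

text \<open>A step shifts the window of two consecutive entries by one place, so \<open>k\<close>
  steps take \<open>k + 2\<close> entries; \<open>(a, b)\<close> is the first window and
  \<open>(x, y)\<close> the last.\<close>

definition walks :: "'p set \<Rightarrow> ('p \<Rightarrow> 'p \<Rightarrow> 'p \<Rightarrow> bool) \<Rightarrow> nat \<Rightarrow> 'p \<Rightarrow> 'p \<Rightarrow> 'p \<Rightarrow> 'p \<Rightarrow> 'p list set" where
  "walks P R k a b x y = {vs. length vs = k + 2 \<and> set vs \<subseteq> P \<and>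
     (\<forall>i<k. R (vs ! i) (vs ! (i + 1)) (vs ! (i + 2))) \<and>
     vs ! 0 = a \<and> vs ! 1 = b \<and> vs ! k = x \<and> vs ! (k + 1) = y}"

definition cyclic_tuples :: "'p set \<Rightarrow> ('p \<Rightarrow> 'p \<Rightarrow> 'p \<Rightarrow> bool) \<Rightarrow> nat \<Rightarrow> 'p list set" where
  "cyclic_tuples P R n = {vs. length vs = n \<and> set vs \<subseteq> P \<and>
     (\<forall>i<n. R (vs ! i) (vs ! ((i + 1) mod n)) (vs ! ((i + 2) mod n)))}"

lemma finite_walks: "finite P \<Longrightarrow> finite (walks P R k a b x y)"
  by (rule finite_subset[OF _ finite_lists_length_eq[of P "k + 2"]]) (auto simp: walks_def)

lemma walks_0:
  assumes "a \<in> P" "b \<in> P"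
  shows "walks P R 0 a b x y = (if x = a \<and> y = b then {[a, b]} else {})"
  using assms by (auto simp: walks_def length_Suc_conv)

text \<open>Deleting the last entry \<open>z\<close> leaves a shorter walk ending in some
  \<open>x, y\<close>, and the only condition lost is the one on the triple
  \<open>x, y, z\<close>.\<close>

lemma walks_Suc:
  assumes "z \<in> P"
  shows "walks P R (Suc k) a b y z =
    (\<Union>x\<in>{x\<in>P. R x y z}. (\<lambda>vs. vs @ [z]) ` walks P R k a b x y)" (is "?A = ?B")
proof (intro equalityI subsetI)
  fix vs assume vs: "vs \<in> ?A"
  define us where "us = butlast vs"
  have len: "length vs = Suc k + 2" using vs by (simp add: walks_def)
  then have ne: "vs \<noteq> []" by auto
  have last: "last vs = z" using vs len by (simp add: walks_def last_conv_nth ne)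
  then have vs_eq: "vs = us @ [z]" unfolding us_def using ne by (metis append_butlast_last_id)
  have lu: "length us = k + 2" using len by (simp add: us_def)
  have nth: "vs ! i = us ! i" if "i < k + 2" for i using that lu by (simp add: vs_eq nth_append)
  have R: "R (vs ! i) (vs ! (i + 1)) (vs ! (i + 2))" if "i < Suc k" for i
    using vs that by (auto simp: walks_def)
  have "R (us ! k) y z" using R[of k] vs nth[of k] by (simp add: walks_def)
  moreover have "us ! k \<in> P" using vs lu by (auto simp: walks_def vs_eq)
  moreover have "us \<in> walks P R k a b (us ! k) y"
    using vs lu R nth[of 0] nth[of 1] nth[of "k + 1"]
    by (auto simp: walks_def vs_eq nth_append split: if_splits)
  ultimately show "vs \<in> ?B" using vs_eq by blast
next
  fix vs assume "vs \<in> ?B"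
  then obtain x us where x: "x \<in> P" "R x y z" and us: "us \<in> walks P R k a b x y"
    and vs: "vs = us @ [z]" by blast
  have R: "R (vs ! i) (vs ! (i + 1)) (vs ! (i + 2))" if "i < Suc k" for i
  proof (cases "i < k")
    case True then show ?thesis using us by (auto simp: walks_def vs nth_append)
  next
    case False
    then have "i = k" using that by simp
    then show ?thesis using us x by (auto simp: walks_def vs nth_append)
  qed
  show "vs \<in> ?A" using us R assms by (auto simp: walks_def vs nth_append)
qed

lemma card_walks_0:
  assumes "a \<in> P" "b \<in> P"
  shows "card (walks P R 0 a b x y) = of_bool (x = a \<and> y = b)"
  using walks_0[OF assms, of R x y] by simp

lemma card_walks_Suc:
  assumes "finite P" "z \<in> P"
  shows "card (walks P R (Suc k) a b y z) = (\<Sum>x | x \<in> P \<and> R x y z. card (walks P R k a b x y))"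
proof -
  have "card (walks P R (Suc k) a b y z)
      = (\<Sum>x | x \<in> P \<and> R x y z. card ((\<lambda>vs. vs @ [z]) ` walks P R k a b x y))"
    unfolding walks_Suc[OF assms(2)] using assms(1)
    by (intro card_UN_disjoint) (auto simp: finite_walks, auto simp: walks_def)
  also have "\<dots> = (\<Sum>x | x \<in> P \<and> R x y z. card (walks P R k a b x y))"
    by (intro sum.cong refl card_image) (auto simp: inj_on_def)
  finally show ?thesis .
qed

text \<open>Repeating the first two entries at the end turns a cyclic tuple into a closed walk and
  removes the reduction of indices mod \<open>n\<close>.\<close>

lemma card_cyclic_tuples:
  assumes "finite P" "n \<ge> 2"
  shows "card (cyclic_tuples P R n) = (\<Sum>a\<in>P. \<Sum>b\<in>P. card (walks P R n a b a b))"
proof -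
  define g where "g vs = vs @ [vs ! 0, vs ! 1]" for vs :: "'a list"
  have "g ` cyclic_tuples P R n = (\<Union>(a,b)\<in>P \<times> P. walks P R n a b a b)" (is "?A = ?B")
  proof (intro equalityI subsetI)
    fix ws assume "ws \<in> ?A"
    then obtain vs where vs: "vs \<in> cyclic_tuples P R n" and ws: "ws = g vs" by blast
    have len: "length vs = n" using vs by (simp add: cyclic_tuples_def)
    have nth1: "ws ! (i + 1) = vs ! ((i + 1) mod n)" if i: "i < n" for i
    proof -
      consider "i + 1 < n" | "i + 1 = n" using i by linarith
      then show ?thesis using len assms by cases (auto simp: ws g_def nth_append)
    qed
    \<comment> \<open>The window can overrun the tuple by one or two places, which are exactly the
      two appended entries.\<close>
    have nth2: "ws ! (i + 2) = vs ! ((i + 2) mod n)" if i: "i < n" for i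
    proof -
      consider "i + 2 < n" | "i + 2 = n" | "i + 2 = n + 1" using i by linarith
      then show ?thesis using len assms by cases (auto simp: ws g_def nth_append mod_Suc)
    qed
    have mem: "vs ! 0 \<in> P" "vs ! 1 \<in> P"
      using vs assms by (auto simp: cyclic_tuples_def subset_iff)
    have "R (ws ! i) (ws ! (i + 1)) (ws ! (i + 2))" if "i < n" for i
      using vs that nth1[OF that] nth2[OF that] len
      by (simp add: cyclic_tuples_def) (simp add: ws g_def nth_append)
    then have "ws \<in> walks P R n (vs ! 0) (vs ! 1) (vs ! 0) (vs ! 1)"
      using vs len assms mem by (auto simp: walks_def cyclic_tuples_def ws g_def nth_append)
    with mem show "ws \<in> ?B" by blast
  next
    fix ws assume "ws \<in> ?B"
    then obtain a b where ab: "a \<in> P" "b \<in> P" and ws: "ws \<in> walks P R n a b a b" by blast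
    define vs where "vs = take n ws"
    have lw: "length ws = n + 2" using ws by (simp add: walks_def)
    have len: "length vs = n" by (simp add: vs_def lw)
    have nth: "ws ! i = vs ! (i mod n)" if i: "i < n + 2" for i
    proof -
      consider "i < n" | "i = n" | "i = n + 1" using i by linarith
      then show ?thesis using ws assms by cases (auto simp: vs_def walks_def mod_Suc)
    qed
    have "R (vs ! i) (vs ! ((i + 1) mod n)) (vs ! ((i + 2) mod n))" if "i < n" for i
      using that ws nth[of i] nth[of "i + 1"] nth[of "i + 2"] by (auto simp: walks_def)
    moreover have "set vs \<subseteq> P"
      using ws set_take_subset[of n ws] by (auto simp: walks_def vs_def)
    ultimately have "vs \<in> cyclic_tuples P R n" by (simp add: cyclic_tuples_def len)
    moreover have "ws = g vs"
    proof (rule nth_equalityI)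
      show "length ws = length (g vs)" by (simp add: g_def lw len)
      fix i assume "i < length ws"
      then consider "i < n" | "i = n" | "i = n + 1" using lw by linarith
      then show "ws ! i = g vs ! i"
        using ws assms by cases (auto simp: g_def len nth_append walks_def vs_def)
    qed
    ultimately show "ws \<in> ?A" by blast
  qed
  moreover have "inj_on g (cyclic_tuples P R n)" by (auto simp: inj_on_def g_def)
  ultimately have "card (cyclic_tuples P R n) = card (\<Union>(a,b)\<in>P \<times> P. walks P R n a b a b)"
    by (metis card_image)
  also have "\<dots> = (\<Sum>(a,b)\<in>P \<times> P. card (walks P R n a b a b))"
    using assms(1) by (subst card_UN_disjoint) (auto simp: finite_walks case_prod_beta, auto simp: walks_def)
  finally show ?thesis by (simp add: sum.cartesian_product)
qed

section \<open>Finite projective planes\<close>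

text \<open>The entries are the values on the Bruhat cells relative to a flag \<open>(a, l)\<close>, in the order
  in which \<open>cell_value\<close> below distinguishes them.\<close>

type_synonym bruhat_coeffs = "int \<times> int \<times> int \<times> int \<times> int \<times> int"

text \<open>Each row gives the new value on one cell as the sum of the old values over all
  predecessors of a flag there. The coefficients of every row add up to \<open>q^2\<close>, the
  number of points off a line.\<close>

fun coxeter_step :: "int \<Rightarrow> bruhat_coeffs \<Rightarrow> bruhat_coeffs" where
  "coxeter_step q (e, s, t, A, B, C) =
    (q^2 * B,
     q^2 * C,
     q * s + (q^2 - q) * B,
     e + (q - 1) * s + (q^2 - q) * C,
     q * A + (q^2 - q) * C,
     t + (q - 1) * B + (q - 1) * A + (q - 1)^2 * C)"

definition bruhat_id_coeff :: "int \<Rightarrow> nat \<Rightarrow> int" where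
  "bruhat_id_coeff q n = fst ((coxeter_step q ^^ n) (1, 0, 0, 0, 0, 0))"

text \<open>The characteristic polynomial is \<open>(X - q\<^sup>2)(X - 1)(X\<^sup>2 + qX + q\<^sup>2)\<close>.\<close>

lemma bruhat_id_coeff_rec:
  "bruhat_id_coeff q (n + 4) = (q^2 - q + 1) * bruhat_id_coeff q (n + 3)
     + (q^3 - 2 * q^2 + q) * bruhat_id_coeff q (n + 2)
     + (q^4 - q^3 + q^2) * bruhat_id_coeff q (n + 1) - q^4 * bruhat_id_coeff q n"
proof -
  \<comment> \<open>The vector after \<open>n\<close> steps may be arbitrary: four more steps are
    unfolded from it, and a polynomial identity remains.\<close>
  obtain e s t A B C where u: "(coxeter_step q ^^ n) (1, 0, 0, 0, 0, 0) = (e, s, t, A, B, C)"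
    by (metis prod_cases6)
  show ?thesis
    by (simp add: bruhat_id_coeff_def numeral_eq_Suc u) algebra
qed

text \<open>The factor \<open>2\<close> or \<open>-1\<close> is the sum of the \<open>n\<close>-th
  powers of the two primitive cube roots of unity. Multiplying by the number of flags avoids
  division; both sides then satisfy the same recurrence of order four and agree for
  \<open>n < 4\<close>.\<close>

lemma bruhat_id_coeff_closed:
  "(q + 1) * (q^2 + q + 1) * bruhat_id_coeff q n =
     q^(2 * n) + (if 3 dvd n then 2 else -1) * (q^(n + 2) + q^(n + 1)) + q^3"
proof (induction n rule: less_induct)
  case (less n)
  let ?D = "(q + 1) * (q^2 + q + 1)"
  let ?c = "\<lambda>n::nat. (if 3 dvd n then 2 else -1 :: int)"
  let ?f = "\<lambda>n. q^(2 * n) + ?c n * (q^(n + 2) + q^(n + 1)) + q^3"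
  consider "n = 0" | "n = 1" | "n = 2" | "n = 3" | m where "n = m + 4"
  proof -
    have "n = 0 \<or> n = 1 \<or> n = 2 \<or> n = 3 \<or> n = (n - 4) + 4" by linarith
    then show thesis using that by blast
  qed
  then show ?case
  proof cases
    case 3
    have "\<not> 3 dvd (2::nat)" by simp
    then show ?thesis using 3 by (simp add: bruhat_id_coeff_def eval_nat_numeral algebra_simps)
  next
    case 5
    have IH: "?D * bruhat_id_coeff q (m + j) = ?f (m + j)" if "j < 4" for j
      using less.IH[of "m + j"] that 5 by simp
    \<comment> \<open>The factor has period three, and any three consecutive values add up to zero,
      so two of them determine the rest.\<close>
    have c: "?c (m + 3) = ?c m" "?c (m + 4) = ?c (m + 1)" "?c (m + 2) = - ?c m - ?c (m + 1)"
      by (simp_all split: if_splits) presburger+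
    obtain c0 c1 where c01: "?c m = c0" "?c (m + 1) = c1" by blast
    have IHs: "?D * bruhat_id_coeff q m = ?f m" "?D * bruhat_id_coeff q (m + 1) = ?f (m + 1)"
      "?D * bruhat_id_coeff q (m + 2) = ?f (m + 2)" "?D * bruhat_id_coeff q (m + 3) = ?f (m + 3)"
      using IH[of 0] IH[of 1] IH[of 2] IH[of 3] by simp_all
    have "?D * bruhat_id_coeff q (m + 4) = (q^2 - q + 1) * ?f (m + 3)
     + (q^3 - 2 * q^2 + q) * ?f (m + 2) + (q^4 - q^3 + q^2) * ?f (m + 1) - q^4 * ?f m"
      unfolding bruhat_id_coeff_rec IHs[symmetric] by algebra
    also have "\<dots> = ?f (m + 4)"
    proof -
      \<comment> \<open>All powers are expressed through \<open>q ^ m\<close>, leaving a polynomial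
        identity in \<open>q\<close>, \<open>q ^ m\<close>, \<open>c0\<close> and
        \<open>c1\<close>.\<close>
      have dbl: "q ^ (2 * (m + j)) = q ^ m * q ^ m * q ^ (2 * j)" for j
        by (simp add: power_add[symmetric] algebra_simps)
      have "q ^ (2 * m) = q ^ m * q ^ m" using dbl[of 0] by simp
      then show ?thesis
        unfolding c c01 dbl by (simp add: power_add) (simp add: algebra_simps eval_nat_numeral)
    qed
    finally show ?thesis using 5 by simp
  qed (simp_all add: bruhat_id_coeff_def numeral_eq_Suc algebra_simps)
qed

section \<open>Incidence in a finite projective plane\<close>

text \<open>The cardinalities are axioms because over a field they come directly from counting
  vectors. Uniqueness of the line through two points follows from
  \<open>card_line_Int\<close>.\<close>

locale finite_projective_plane =
  fixes P :: "'p set" and Ls :: "'p set set" and q :: nat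
  assumes finite_points: "finite P"
    and card_points: "card P = q^2 + q + 1"
    and order_pos: "q > 0"
    and line_subset: "L \<in> Ls \<Longrightarrow> L \<subseteq> P"
    and card_line: "L \<in> Ls \<Longrightarrow> card L = q + 1"
    and ex_line: "x \<in> P \<Longrightarrow> y \<in> P \<Longrightarrow> x \<noteq> y \<Longrightarrow> \<exists>L\<in>Ls. x \<in> L \<and> y \<in> L"
    and card_line_Int: "L \<in> Ls \<Longrightarrow> M \<in> Ls \<Longrightarrow> L \<noteq> M \<Longrightarrow> card (L \<inter> M) = 1"
begin

definition indep :: "'p \<Rightarrow> 'p \<Rightarrow> 'p \<Rightarrow> bool" where
  "indep x y z \<longleftrightarrow> \<not> (\<exists>L\<in>Ls. x \<in> L \<and> y \<in> L \<and> z \<in> L)"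

definition line :: "'p \<Rightarrow> 'p \<Rightarrow> 'p set" where
  "line x y = (SOME L. L \<in> Ls \<and> x \<in> L \<and> y \<in> L)"

lemma finite_line: "L \<in> Ls \<Longrightarrow> finite L"
  using line_subset finite_points finite_subset by blast

lemma line_unique:
  assumes "L \<in> Ls" "M \<in> Ls" "x \<in> L" "y \<in> L" "x \<in> M" "y \<in> M" "x \<noteq> y"
  shows "L = M"
proof (rule ccontr)
  assume "L \<noteq> M"
  with assms(1,2) have "card (L \<inter> M) = 1" by (rule card_line_Int)
  then obtain w where "L \<inter> M = {w}" by (rule card_1_singletonE)
  moreover have "x \<in> L \<inter> M" "y \<in> L \<inter> M" using assms by auto
  ultimately show False using assms(7) by simp
qed

lemma line_Int_eq:
  assumes "L \<in> Ls" "M \<in> Ls" "L \<noteq> M" "x \<in> L" "x \<in> M"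
  shows "L \<inter> M = {x}"
proof -
  obtain w where w: "L \<inter> M = {w}" using card_line_Int[OF assms(1-3)] by (rule card_1_singletonE)
  moreover have "x \<in> L \<inter> M" using assms(4,5) by (rule IntI)
  ultimately show ?thesis by simp
qed

lemma
  assumes "x \<in> P" "y \<in> P" "x \<noteq> y"
  shows line_mem: "line x y \<in> Ls" and line_left: "x \<in> line x y" and line_right: "y \<in> line x y"
proof -
  have "line x y \<in> Ls \<and> x \<in> line x y \<and> y \<in> line x y"
    unfolding line_def by (rule someI_ex) (use ex_line[OF assms] in auto)
  then show "line x y \<in> Ls" "x \<in> line x y" "y \<in> line x y" by auto
qed

lemma line_eq:
  assumes "L \<in> Ls" "x \<in> L" "y \<in> L" "x \<noteq> y"
  shows "line x y = L"
proof -
  have "x \<in> P" "y \<in> P" using assms line_subset by auto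
  with assms(4) show ?thesis
    using line_unique[OF line_mem assms(1) line_left line_right assms(2,3)] by simp
qed

lemma ex_line_any:
  assumes "x \<in> P" "y \<in> P"
  shows "\<exists>L\<in>Ls. x \<in> L \<and> y \<in> L"
proof (cases "x = y")
  case True
  have "P \<noteq> {x}" using card_points order_pos by auto
  then obtain z where "z \<in> P" "z \<noteq> x" using assms by blast
  then show ?thesis using True ex_line assms by blast
qed (use assms ex_line in blast)

lemma indep_iff:
  assumes "x \<in> P" "y \<in> P" "z \<in> P" "y \<noteq> z"
  shows "indep x y z \<longleftrightarrow> x \<notin> line y z"
  unfolding indep_def using assms line_eq line_mem line_left line_right by metis

lemma not_indep_same:
  assumes "x \<in> P" "y \<in> P"
  shows "\<not> indep x y y"
  using ex_line_any[OF assms] by (auto simp: indep_def)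

section \<open>Bruhat cells and the Coxeter step\<close>

lemma card_minus_line: "M \<in> Ls \<Longrightarrow> int (card (P - M)) = int q ^ 2"
  using card_points card_line line_subset finite_line by (simp add: card_Diff_subset)

text \<open>The second line meets the first in one point, so it removes only \<open>q\<close> of the
  \<open>q^2\<close> points off the first.\<close>

lemma card_minus_lines:
  assumes "M \<in> Ls" "L \<in> Ls" "M \<noteq> L"
  shows "int (card (P - M - L)) = int q ^ 2 - int q"
proof -
  have "card (L - M) + card (L \<inter> M) = card L"
    using assms finite_line by (metis Int_Diff_Un Int_Diff_disjoint Int_commute add.commute card_Un_disjoint finite_Diff finite_Int)
  then have "card (L - M) = q" using card_line card_line_Int assms by force
  moreover have "card (P - M) = card (P - M - L) + card (L - M)"
    using finite_points line_subset[OF assms(2)] finite_line[OF assms(2)]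
    by (subst card_Un_disjoint[symmetric]) (auto intro!: arg_cong[of _ _ card])
  ultimately show ?thesis using card_minus_line[OF assms(1)] by linarith
qed

text \<open>The pair \<open>x, y\<close> stands for the flag \<open>(x, line x y)\<close>; the value is meaningful only for \<open>x \<noteq> y\<close>.\<close>

fun cell_value :: "'p \<Rightarrow> 'p set \<Rightarrow> bruhat_coeffs \<Rightarrow> 'p \<Rightarrow> 'p \<Rightarrow> int" where
  "cell_value a l (e, s, t, A, B, C) x y =
    (if x = a then (if y \<in> l then e else t)
     else if x \<in> l then (if y \<in> l then s else A)
     else if a \<in> line x y then B else C)"

text \<open>The predecessors of the pair \<open>y, z\<close> are the points \<open>x\<close> off
  \<open>line y z\<close>. For fixed \<open>y\<close>, the cell of \<open>x, y\<close> depends only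
  on whether \<open>x\<close> is \<open>a\<close>, lies on \<open>l\<close>, or lies on the line
  through \<open>a\<close> and \<open>y\<close>; counting the points of each kind gives one row of
  \<open>coxeter_step\<close>.\<close>

lemma cell_value_step:
  assumes a: "a \<in> l" and l: "l \<in> Ls" and y: "y \<in> P" and z: "z \<in> P" and yz: "y \<noteq> z"
  shows "(\<Sum>x\<in>P - line y z. cell_value a l u x y) = cell_value a l (coxeter_step (int q) u) y z"
proof -
  obtain e s t A B C where u: "u = (e, s, t, A, B, C)" by (metis prod_cases6)
  define m where "m = line y z"
  have m: "m \<in> Ls" "y \<in> m" "z \<in> m" using line_mem line_left line_right y z yz by (auto simp: m_def)
  have aP: "a \<in> P" and lP: "l \<subseteq> P" using line_subset a l by auto
  have fin: "finite P" "finite l" "finite m" using finite_points finite_line l m by auto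
  note c = card_minus_line[OF m(1)] card_minus_lines[OF m(1) l] card_line[OF l] card_line[OF m(1)]
  let ?v = "\<lambda>x. cell_value a l u x y"
  have const: "(\<Sum>x\<in>S. ?v x) = int (card S) * k" if "\<And>x. x \<in> S \<Longrightarrow> ?v x = k" for S k
    using that by simp
  have split: "(\<Sum>x\<in>P - m. ?v x) = (\<Sum>x\<in>P - m - l. ?v x) + (\<Sum>x\<in>l - m. ?v x)"
    using fin lP by (subst sum.union_disjoint[symmetric]) (auto intro!: sum.cong)
  have z_l: "z \<in> l \<longleftrightarrow> m = l" if "y \<in> l" using that l m yz line_unique by blast
  have a_line: "a \<in> line x y \<longleftrightarrow> x \<in> line a y" if "x \<in> P" "x \<noteq> y" "a \<noteq> y" "x \<noteq> a" for x
    using that aP y line_eq line_mem line_left line_right by metis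
  have l_line: "a \<notin> line x y" if "x \<in> P" "x \<notin> l" "y \<in> l" "y \<noteq> a" for x
    using that a l line_unique[OF l line_mem[of x y]] line_left[of x y] line_right[of x y] y by blast
  \<comment> \<open>These are the cells of the flag \<open>(y, m)\<close>, in the order
    \<open>e\<close>, \<open>t\<close>, \<open>s\<close>, \<open>A\<close>, \<open>B\<close>,
    \<open>C\<close>.\<close>
  consider (1) "y = a" "m = l" | (2) "y = a" "m \<noteq> l" | (3) "y \<in> l" "y \<noteq> a" "m = l"
    | (4) "y \<in> l" "y \<noteq> a" "m \<noteq> l" | (5) "y \<notin> l" "a \<in> m" | (6) "y \<notin> l" "a \<notin> m" by blast
  then have "(\<Sum>x\<in>P - m. ?v x) = cell_value a l (coxeter_step (int q) u) y z"
  proof cases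
    case 1
    have "(\<Sum>x\<in>P - m. ?v x) = int (card (P - m)) * B"
      by (rule const) (use 1 a aP line_right in \<open>auto simp: u\<close>)
    then show ?thesis using 1 c z_l a by (simp add: u)
  next
    case 2
    have I: "l \<inter> m = {a}" by (rule line_Int_eq) (use 2 a l m in auto)
    have "card (l - m) = q" using c card_Diff_subset_Int[of l m] fin I by simp
    moreover have "(\<Sum>x\<in>P - m - l. ?v x) = int (card (P - m - l)) * B"
      by (rule const) (use 2 aP a line_right in \<open>auto simp: u\<close>)
    moreover have "(\<Sum>x\<in>l - m. ?v x) = int (card (l - m)) * s"
      by (rule const) (use 2 a m in \<open>auto simp: u\<close>)
    ultimately show ?thesis using 2 c z_l a split by (simp add: u)
  next
    case 3
    have "(\<Sum>x\<in>P - m. ?v x) = int (card (P - m)) * C"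
      by (rule const) (use 3 a l_line in \<open>auto simp: u\<close>)
    then show ?thesis using 3 c z_l a by (simp add: u)
  next
    case 4
    have I: "l \<inter> m = {y}" by (rule line_Int_eq) (use 4 l m in auto)
    have "a \<notin> m" using I 4(2) a by (metis IntI singletonD)
    have "card (l - m) = q" using c card_Diff_subset_Int[of l m] fin I by simp
    then have "card (l - m - {a}) = q - 1" using \<open>a \<notin> m\<close> a by simp
    moreover have "(\<Sum>x\<in>P - m - l. ?v x) = int (card (P - m - l)) * C"
      by (rule const) (use 4 a l_line in \<open>auto simp: u\<close>)
    \<comment> \<open>The point \<open>a\<close> is split off because it contributes
      \<open>e\<close>, while the other \<open>q - 1\<close> points of \<open>l - m\<close>
      contribute \<open>s\<close>.\<close>
    moreover have "(\<Sum>x\<in>l - m. ?v x) = ?v a + (\<Sum>x\<in>l - m - {a}. ?v x)"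
      using \<open>a \<notin> m\<close> a fin by (intro sum.remove) auto
    moreover have "(\<Sum>x\<in>l - m - {a}. ?v x) = int (card (l - m - {a})) * s"
      by (rule const) (use 4 in \<open>auto simp: u\<close>)
    ultimately show ?thesis using 4 c z_l a split order_pos by (simp add: u of_nat_diff)
  next
    case 5
    have "m \<noteq> l" "a \<noteq> y" using 5 m a by auto
    have I: "l \<inter> m = {a}" by (rule line_Int_eq) (use \<open>m \<noteq> l\<close> 5 a l m in auto)
    have ma: "line a y = m" using line_eq m 5 \<open>a \<noteq> y\<close> by blast
    have "card (l - m) = q" using c card_Diff_subset_Int[of l m] fin I by simp
    moreover have "(\<Sum>x\<in>P - m - l. ?v x) = int (card (P - m - l)) * C"
      by (rule const) (use 5 a a_line ma m \<open>a \<noteq> y\<close> in \<open>auto simp: u\<close>)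
    moreover have "(\<Sum>x\<in>l - m. ?v x) = int (card (l - m)) * A"
      by (rule const) (use 5 a m in \<open>auto simp: u\<close>)
    ultimately show ?thesis using 5 \<open>m \<noteq> l\<close> \<open>a \<noteq> y\<close> c split by (simp add: u m_def)
  next
    case 6
    have "m \<noteq> l" "a \<noteq> y" using 6 m a by auto
    obtain w where I: "l \<inter> m = {w}"
      using card_line_Int[OF l m(1)] \<open>m \<noteq> l\<close> by (metis card_1_singletonE)
    \<comment> \<open>Off \<open>l\<close>, the line \<open>k\<close> separates the cell
      \<open>B\<close> from the cell \<open>C\<close>. The points off \<open>m\<close> thus split
      into \<open>a\<close> with value \<open>t\<close>, \<open>q - 1\<close> points with
      \<open>A\<close>, \<open>q - 1\<close> with \<open>B\<close> and \<open>(q - 1)^2\<close> with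
      \<open>C\<close>.\<close>
    define k where "k = line a y"
    have k: "k \<in> Ls" "a \<in> k" "y \<in> k"
      using line_mem line_left line_right aP y \<open>a \<noteq> y\<close> by (auto simp: k_def)
    have kl: "k \<inter> l = {a}" by (rule line_Int_eq) (use k a l 6 in auto)
    have km: "k \<inter> m = {y}" by (rule line_Int_eq) (use k m 6 in auto)
    have kP: "k \<subseteq> P" "finite k" using k line_subset finite_line by auto
    have "card (l - m) = q" using c card_Diff_subset_Int[of l m] fin I by simp
    then have cl: "card (l - m - {a}) = q - 1" using 6 a by simp
    have "k - m - l = k - {a, y}" using kl km by blast
    then have ck: "card (k - m - l) = q - 1"
      using card_line[OF k(1)] k kP \<open>a \<noteq> y\<close> by (simp add: card_Diff_subset)
    have "card (P - m - l) = card (P - m - l - k) + card (k - m - l)"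
      using fin kP by (subst card_Un_disjoint[symmetric]) (auto intro!: arg_cong[of _ _ card])
    then have cr: "int (card (P - m - l - k)) = (int q - 1)^2"
      using ck c \<open>m \<noteq> l\<close> order_pos by (simp add: of_nat_diff power2_eq_square algebra_simps)
    have "(\<Sum>x\<in>l - m. ?v x) = ?v a + (\<Sum>x\<in>l - m - {a}. ?v x)"
      using 6 a fin by (intro sum.remove) auto
    moreover have "(\<Sum>x\<in>l - m - {a}. ?v x) = int (card (l - m - {a})) * A"
      by (rule const) (use 6 in \<open>auto simp: u\<close>)
    moreover have "(\<Sum>x\<in>P - m - l. ?v x) = (\<Sum>x\<in>P - m - l - k. ?v x) + (\<Sum>x\<in>k - m - l. ?v x)"
      using fin kP by (subst sum.union_disjoint[symmetric]) (auto intro!: sum.cong)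
    moreover have "(\<Sum>x\<in>P - m - l - k. ?v x) = int (card (P - m - l - k)) * C"
      by (rule const) (use 6 a a_line m \<open>a \<noteq> y\<close> in \<open>auto simp: u k_def\<close>)
    moreover have "(\<Sum>x\<in>k - m - l. ?v x) = int (card (k - m - l)) * B"
      by (rule const) (use 6 a a_line m kP \<open>a \<noteq> y\<close> in \<open>auto simp: u k_def\<close>)
    ultimately show ?thesis
      using 6 \<open>a \<noteq> y\<close> cl ck cr split order_pos by (simp add: u of_nat_diff m_def)
  qed
  then show ?thesis by (simp add: m_def)
qed

section \<open>Walks from a fixed flag\<close>

abbreviation walk_count :: "nat \<Rightarrow> 'p \<Rightarrow> 'p \<Rightarrow> 'p \<Rightarrow> 'p \<Rightarrow> int" where
  "walk_count k a b x y \<equiv> int (card (walks P indep k a b x y))"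

lemma walk_count_Suc:
  assumes "y \<in> P" "z \<in> P" "y \<noteq> z"
  shows "walk_count (Suc k) a b y z = (\<Sum>x\<in>P - line y z. walk_count k a b x y)"
proof -
  have "{x \<in> P. indep x y z} = P - line y z" using indep_iff assms by auto
  then show ?thesis using card_walks_Suc[OF finite_points assms(2), of indep k a b y] by simp
qed

text \<open>Summing over \<open>b\<close> forgets the second point and keeps the initial flag
  \<open>(a, l)\<close>. For \<open>k = 0\<close> this is the indicator of the identity cell, and
  \<open>cell_value_step\<close> carries it through each further step.\<close>

lemma sum_walk_count:
  assumes "a \<in> l" "l \<in> Ls" "x \<in> P" "y \<in> P" "x \<noteq> y"
  shows "(\<Sum>b\<in>l - {a}. walk_count k a b x y) =
    cell_value a l ((coxeter_step (int q) ^^ k) (1, 0, 0, 0, 0, 0)) x y"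
  using assms(3-5)
proof (induction k arbitrary: x y)
  case 0
  have "(\<Sum>b\<in>l - {a}. walk_count 0 a b x y) = (\<Sum>b\<in>l - {a}. if y = b then of_bool (x = a) else 0)"
    using assms(1,2) line_subset by (intro sum.cong refl, subst card_walks_0) auto
  \<comment> \<open>The condition \<open>y \<noteq> a\<close> is absorbed: with \<open>x = a\<close>
    it follows from \<open>x \<noteq> y\<close>.\<close>
  also have "\<dots> = of_bool (x = a \<and> y \<in> l)"
    using 0 finite_line assms by (auto simp: sum.delta')
  finally show ?case using 0 by auto
next
  case (Suc k)
  have "(\<Sum>b\<in>l - {a}. walk_count (Suc k) a b x y)
      = (\<Sum>b\<in>l - {a}. \<Sum>w\<in>P - line x y. walk_count k a b w x)"
    using walk_count_Suc Suc.prems by simp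
  also have "\<dots> = (\<Sum>w\<in>P - line x y. \<Sum>b\<in>l - {a}. walk_count k a b w x)" by (rule sum.swap)
  also have "\<dots> = (\<Sum>w\<in>P - line x y. cell_value a l ((coxeter_step (int q) ^^ k) (1, 0, 0, 0, 0, 0)) w x)"
    using Suc line_left by (intro sum.cong refl) (metis DiffD1 DiffD2)
  also have "\<dots> = cell_value a l (coxeter_step (int q) ((coxeter_step (int q) ^^ k) (1, 0, 0, 0, 0, 0))) x y"
    using cell_value_step assms(1,2) Suc.prems by blast
  finally show ?case by simp
qed

text \<open>The end point varies with the summation index here, so it is first replaced by a fixed
  point \<open>c\<close> of \<open>l\<close> other than \<open>a\<close>; then
  \<open>sum_walk_count\<close> applies.\<close>

lemma sum_closed_walks_line:
  assumes "a \<in> l" "l \<in> Ls" "n > 0"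
  shows "(\<Sum>b\<in>l - {a}. walk_count n a b a b) = bruhat_id_coeff (int q) n"
proof -
  have "card (l - {a}) = q" using assms card_line by simp
  then have "l - {a} \<noteq> {}" using order_pos by (metis card.empty less_irrefl)
  then obtain c where c: "c \<in> l" "c \<noteq> a" by blast
  obtain k where n: "n = Suc k" using assms(3) gr0_implies_Suc by blast
  have lP: "l \<subseteq> P" using assms line_subset by blast
  \<comment> \<open>A walk of positive length sees its last point only through the line to its predecessor.\<close>
  have "walk_count n a b a b = walk_count n a b a c" if "b \<in> l - {a}" for b
  proof -
    have "line a b = l" "line a c = l" "a \<in> P" "b \<in> P" "c \<in> P" "a \<noteq> b" "a \<noteq> c"
      using that line_eq c assms lP by auto
    then show ?thesis by (simp add: n walk_count_Suc del: of_nat_eq_iff)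
  qed
  then have "(\<Sum>b\<in>l - {a}. walk_count n a b a b) = (\<Sum>b\<in>l - {a}. walk_count n a b a c)" by simp
  also have "\<dots> = cell_value a l ((coxeter_step (int q) ^^ n) (1, 0, 0, 0, 0, 0)) a c"
    using sum_walk_count assms c lP by blast
  also have "\<dots> = bruhat_id_coeff (int q) n"
    using c by (cases "(coxeter_step (int q) ^^ n) (1, 0, 0, 0, 0, 0)") (simp add: bruhat_id_coeff_def)
  finally show ?thesis .
qed

section \<open>Pencils and the total count\<close>

text \<open>The lines through \<open>a\<close>, with \<open>a\<close> removed, partition the
  remaining points.\<close>

lemma sum_pencil:
  assumes "a \<in> P"
  shows "(\<Sum>b\<in>P - {a}. f b) = (\<Sum>l\<in>{l\<in>Ls. a \<in> l}. \<Sum>b\<in>l - {a}. f b)"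
proof -
  have "finite Ls" using line_subset finite_points by (metis Pow_iff finite_Pow_iff finite_subset subsetI)
  moreover have "P - {a} = (\<Union>l\<in>{l\<in>Ls. a \<in> l}. l - {a})"
    using line_subset ex_line[OF assms] by blast
  moreover have "(l - {a}) \<inter> (m - {a}) = {}"
    if "l \<in> Ls" "a \<in> l" "m \<in> Ls" "a \<in> m" "l \<noteq> m" for l m
    using that line_unique by blast
  ultimately show ?thesis
    using finite_line by (simp only:) (intro sum.UNION_disjoint, auto)
qed

text \<open>Each line of the pencil accounts for \<open>q\<close> of the \<open>q^2 + q\<close>
  points other than \<open>a\<close>.\<close>

lemma card_pencil:
  assumes "a \<in> P"
  shows "card {l\<in>Ls. a \<in> l} = q + 1"
proof -
  have "card (P - {a}) = (\<Sum>l\<in>{l\<in>Ls. a \<in> l}. card (l - {a}))"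
    using sum_pencil[OF assms, of "\<lambda>_. 1::nat"] by simp
  also have "\<dots> = card {l\<in>Ls. a \<in> l} * q" using card_line by simp
  finally have "card {l\<in>Ls. a \<in> l} * q = (q + 1) * q"
    using assms card_points finite_points by (simp add: power2_eq_square)
  then show ?thesis using order_pos by (metis mult_right_cancel less_irrefl)
qed

theorem card_cyclic_tuples_indep:
  assumes "n \<ge> 2"
  shows "int (card (cyclic_tuples P indep n)) =
    int q ^ (2 * n) + (if 3 dvd n then 2 else -1) * (int q ^ (n + 2) + int q ^ (n + 1)) + int q ^ 3"
proof -
  \<comment> \<open>A walk of positive length cannot end in \<open>a, a\<close>, since its last
    triple would be collinear. Only \<open>b \<noteq> a\<close> remains, and these \<open>b\<close>
    are grouped by the lines through \<open>a\<close>.\<close>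
  have diag: "walk_count n a a a a = 0" if "a \<in> P" for a
  proof -
    obtain k where n: "n = Suc k" using assms by (cases n) auto
    have "{x. x \<in> P \<and> indep x a a} = {}" using not_indep_same that by blast
    then show ?thesis using card_walks_Suc[OF finite_points that, of indep k a a a] n by (simp only: sum.empty of_nat_0)
  qed
  have "int (card (cyclic_tuples P indep n)) = (\<Sum>a\<in>P. \<Sum>b\<in>P. walk_count n a b a b)"
    by (simp add: card_cyclic_tuples[OF finite_points assms])
  also have "\<dots> = (\<Sum>a\<in>P. (int q + 1) * bruhat_id_coeff (int q) n)"
  proof (rule sum.cong[OF refl])
    fix a assume a: "a \<in> P"
    have "(\<Sum>b\<in>P. walk_count n a b a b) = (\<Sum>b\<in>P - {a}. walk_count n a b a b)"
      using sum.remove[OF finite_points a, of "\<lambda>b. walk_count n a b a b"] diag[OF a] by simp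
    also have "\<dots> = (\<Sum>l\<in>{l\<in>Ls. a \<in> l}. bruhat_id_coeff (int q) n)"
      unfolding sum_pencil[OF a] using sum_closed_walks_line assms by (intro sum.cong) auto
    also have "\<dots> = (int q + 1) * bruhat_id_coeff (int q) n" by (simp add: card_pencil[OF a])
    finally show "(\<Sum>b\<in>P. walk_count n a b a b) = (int q + 1) * bruhat_id_coeff (int q) n" .
  qed
  also have "\<dots> = (int q + 1) * (int q ^ 2 + int q + 1) * bruhat_id_coeff (int q) n"
    by (simp add: card_points algebra_simps)
  finally show ?thesis using bruhat_id_coeff_closed by simp
qed

end

section \<open>The projective plane over a finite field\<close>

definition proj_points_in :: "('a::field ^ 3) set \<Rightarrow> ('a ^ 3) set set" where
  "proj_points_in S = {p \<in> proj_plane. p \<subseteq> S}"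

text \<open>A line is encoded by its set of points rather than by a subspace, to match the
  locale.\<close>

definition proj_lines :: "('a::field ^ 3) set set set" where
  "proj_lines = proj_points_in ` {S. vec.subspace S \<and> vec.dim S = 2}"

section \<open>Counting points of subspaces\<close>

lemma proj_planeE:
  assumes "p \<in> proj_plane" "x \<in> lifts p"
  shows "p = vec.span {x}"
proof -
  have p: "vec.subspace p" "vec.dim p = 1" and x: "x \<in> p" "x \<noteq> 0"
    using assms by (auto simp: proj_plane_def lifts_def)
  have "p \<subseteq> vec.span {x}"
    using vec.card_ge_dim_independent[of "{x}" p] p x by simp
  moreover have "vec.span {x} \<subseteq> p" using p x by (simp add: vec.span_minimal)
  ultimately show ?thesis by blast
qed

lemma span_in_proj_plane: "x \<noteq> 0 \<Longrightarrow> vec.span {x} \<in> proj_plane"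
  by (simp add: proj_plane_def vec.subspace_span vec.dim_eq_card_independent)

lemma lifts_nonempty:
  assumes "p \<in> proj_plane"
  shows "\<exists>x. x \<in> lifts p"
proof -
  have "\<not> p \<subseteq> {0}" using assms vec.dim_eq_0[of p] by (auto simp: proj_plane_def)
  then show ?thesis by (auto simp: lifts_def)
qed

lemma card_lifts:
  fixes p :: "('a::{field,finite} ^ 3) set"
  assumes "p \<in> proj_plane"
  shows "card (lifts p) = CARD('a) - 1"
proof -
  obtain x where x: "x \<in> lifts p" using lifts_nonempty assms by blast
  have "p = range (\<lambda>c. c *s x)" using proj_planeE[OF assms x] by (simp add: vec.span_singleton)
  moreover have "inj (\<lambda>c. c *s x)" using x by (auto simp: inj_def lifts_def)
  ultimately have "card p = CARD('a)" by (simp add: card_image)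
  moreover have "0 \<in> p" using assms by (simp add: proj_plane_def vec.subspace_0)
  ultimately show ?thesis by (simp add: lifts_def)
qed

text \<open>The nonzero vectors of \<open>S\<close> are partitioned into the lifts of its points,
  \<open>CARD('a) - 1\<close> vectors for each point.\<close>

lemma card_proj_points_in:
  fixes S :: "('a::{field,finite} ^ 3) set"
  assumes "vec.subspace S"
  shows "card S = card (proj_points_in S) * (CARD('a) - 1) + 1"
proof -
  have "S - {0} = (\<Union>p\<in>proj_points_in S. lifts p)"
  proof (intro equalityI subsetI)
    fix x assume x: "x \<in> S - {0}"
    then have "vec.span {x} \<in> proj_points_in S"
      using assms span_in_proj_plane by (auto simp: proj_points_in_def vec.span_minimal subsetD[OF vec.span_minimal])
    moreover have "x \<in> lifts (vec.span {x})" using x by (simp add: lifts_def vec.span_base)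
    ultimately show "x \<in> (\<Union>p\<in>proj_points_in S. lifts p)" by blast
  qed (auto simp: proj_points_in_def lifts_def)
  moreover have "card (\<Union>p\<in>proj_points_in S. lifts p) = (\<Sum>p\<in>proj_points_in S. card (lifts p))"
  proof (rule card_UN_disjoint)
    show "\<forall>p\<in>proj_points_in S. \<forall>r\<in>proj_points_in S. p \<noteq> r \<longrightarrow> lifts p \<inter> lifts r = {}"
      using proj_planeE unfolding proj_points_in_def by blast
  qed auto
  moreover have "\<dots> = card (proj_points_in S) * (CARD('a) - 1)"
    by (simp add: proj_points_in_def card_lifts)
  moreover have "0 \<in> S" using assms by (simp add: vec.subspace_0)
  ultimately show ?thesis by (metis Suc_eq_plus1 card_Suc_Diff1 finite)
qed

text \<open>Coordinates with respect to a basis identify \<open>S\<close> with pairs of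
  scalars.\<close>

lemma card_dim_2:
  fixes S :: "('a::{field,finite} ^ 3) set"
  assumes "vec.subspace S" "vec.dim S = 2"
  shows "card S = CARD('a) ^ 2"
proof -
  obtain B where B: "B \<subseteq> S" "vec.independent B" "S \<subseteq> vec.span B" "card B = 2"
    using vec.basis_exists[of S] assms by metis
  then obtain x y where xy: "B = {x, y}" "x \<noteq> y" by (auto simp: card_2_iff)
  have ind: "x \<notin> vec.span {y}" "y \<noteq> 0"
    using B xy by (auto simp: vec.independent_insert)
  have S: "S = vec.span {x, y}" using B xy assms by (metis subset_antisym vec.span_minimal)
  let ?h = "\<lambda>(c, d). c *s x + d *s y"
  have "S = range ?h"
  proof (intro equalityI subsetI)
    fix v assume "v \<in> S"
    then obtain c d where "v - c *s x = d *s y"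
      unfolding S by (auto simp: vec.span_insert vec.span_singleton)
    then have "v = ?h (c, d)" by (simp add: algebra_simps)
    then show "v \<in> range ?h" by blast
  next
    fix v assume "v \<in> range ?h"
    then show "v \<in> S" unfolding S by (auto intro: vec.span_add vec.span_scale vec.span_base)
  qed
  moreover have "inj ?h"
  proof (rule injI, clarsimp)
    fix c d c' d' assume eq: "c *s x + d *s y = c' *s x + d' *s y"
    have *: "(c - c') *s x = (d' - d) *s y"
      using eq by (simp add: algebra_simps vec.scale_left_diff_distrib)
    have "c = c'"
    proof (rule ccontr)
      assume "c \<noteq> c'"
      then have "x = inverse (c - c') *s ((c - c') *s x)" by simp
      also have "\<dots> = (inverse (c - c') * (d' - d)) *s y" by (simp only: * vec.scale_scale)
      finally have "x = (inverse (c - c') * (d' - d)) *s y" .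
      then show False using ind by (metis vec.span_base vec.span_scale singletonI)
    qed
    then show "c = c' \<and> d = d'" using * ind by simp
  qed
  ultimately have "card S = CARD('a \<times> 'a)" by (metis card_image)
  then show ?thesis by (simp add: power2_eq_square)
qed

lemma card_field_ge_2: "CARD('a::{field,finite}) \<ge> 2"
proof -
  have "card {0, 1::'a} \<le> CARD('a)" by (rule card_mono) auto
  then show ?thesis by simp
qed

lemma proj_points_in_UNIV: "proj_points_in UNIV = proj_plane"
  by (simp add: proj_points_in_def)

section \<open>Joining points and intersecting lines\<close>

lemma independent_lifts:
  assumes "p \<in> proj_plane" "r \<in> proj_plane" "p \<noteq> r" "x \<in> lifts p" "y \<in> lifts r"
  shows "vec.independent {x, y}" "x \<noteq> y"
proof -
  have "x \<notin> vec.span {y}"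
    using assms proj_planeE by (metis DiffD2 DiffI lifts_def)
  then show "vec.independent {x, y}" "x \<noteq> y"
    using assms by (auto simp: vec.independent_insert lifts_def vec.span_base)
qed

lemma proj_plane_subset_iff:
  assumes "p \<in> proj_plane" "x \<in> lifts p" "vec.subspace S"
  shows "p \<subseteq> S \<longleftrightarrow> x \<in> S"
proof
  assume "x \<in> S"
  then show "p \<subseteq> S" unfolding proj_planeE[OF assms(1,2)] using assms(3) by (simp add: vec.span_minimal)
qed (use assms(2) in \<open>auto simp: lifts_def\<close>)

lemma ex_proj_line:
  assumes "p \<in> proj_plane" "r \<in> proj_plane" "p \<noteq> r" "x \<in> lifts p" "y \<in> lifts r"
  shows "proj_points_in (vec.span {x, y}) \<in> proj_lines"
    "p \<in> proj_points_in (vec.span {x, y})" "r \<in> proj_points_in (vec.span {x, y})"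
proof -
  have "vec.dim (vec.span {x, y}) = 2"
    using independent_lifts[OF assms] by (simp add: vec.dim_eq_card_independent)
  then show "proj_points_in (vec.span {x, y}) \<in> proj_lines" by (auto simp: proj_lines_def vec.subspace_span)
  show "p \<in> proj_points_in (vec.span {x, y})" "r \<in> proj_points_in (vec.span {x, y})"
    using assms proj_plane_subset_iff[OF assms(1,4) vec.subspace_span]
      proj_plane_subset_iff[OF assms(2,5) vec.subspace_span]
    by (simp_all add: proj_points_in_def vec.span_base)
qed

text \<open>By the dimension formula the sum and the intersection have dimensions adding up to 4.
  The sum has dimension at most 3, and dimension 2 would make both planes equal to it; so the
  intersection is one-dimensional and is itself the only common point.\<close>

lemma card_proj_line_Int:
  fixes S T :: "('a::field ^ 3) set"
  assumes S: "vec.subspace S" "vec.dim S = 2" and T: "vec.subspace T" "vec.dim T = 2" and "S \<noteq> T"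
  shows "card (proj_points_in S \<inter> proj_points_in T) = 1"
proof -
  let ?U = "{x + y |x y. x \<in> S \<and> y \<in> T}"
  have dims: "vec.dim ?U + vec.dim (S \<inter> T) = 4" using vec.dim_sums_Int[OF S(1) T(1)] S T by simp
  have U: "vec.subspace ?U" using vec.subspace_sums S T by blast
  have "vec.dim ?U \<le> 3" using vec.dim_subset_UNIV[of ?U] by (simp add: vec.dimension_def card_cart_basis)
  moreover have "vec.dim ?U \<noteq> 2"
  proof
    assume d: "vec.dim ?U = 2"
    have "S \<subseteq> ?U" using T vec.subspace_0 by force
    then have "S = ?U" using d S by (intro vec.subspace_dim_equal U) auto
    have "T \<subseteq> ?U" using S vec.subspace_0 by force
    then have "T = ?U" using d T by (intro vec.subspace_dim_equal U) auto
    with \<open>S = ?U\<close> \<open>S \<noteq> T\<close> show False by argo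
  qed
  moreover have "vec.dim (S \<inter> T) \<le> 2" using vec.dim_subset[of "S \<inter> T" S] S by simp
  ultimately have d: "vec.dim (S \<inter> T) = 1" using dims by linarith
  have sub: "vec.subspace (S \<inter> T)" using S T vec.subspace_inter by blast
  have "proj_points_in S \<inter> proj_points_in T = {S \<inter> T}"
  proof (intro equalityI subsetI)
    fix p assume "p \<in> proj_points_in S \<inter> proj_points_in T"
    then show "p \<in> {S \<inter> T}"
      using vec.subspace_dim_equal[of p "S \<inter> T"] sub d by (auto simp: proj_points_in_def proj_plane_def)
  qed (use sub d in \<open>auto simp: proj_points_in_def proj_plane_def\<close>)
  then show ?thesis by simp
qed

lemma finite_projective_plane_proj_plane:
  "finite_projective_plane (proj_plane :: ('a::{field,finite} ^ 3) set set) proj_lines CARD('a)"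
proof
  let ?q = "CARD('a)"
  have q: "?q \<ge> 2" by (rule card_field_ge_2)
  have cancel: "k = m" if "k * (?q - 1) = m * (?q - 1)" for k m :: nat using that q by simp
  \<comment> \<open>Substituting \<open>r + 1\<close> for the order turns the truncated subtraction
    into \<open>r\<close>; cancelling this factor from the vector counts gives the point
    counts.\<close>
  obtain r where r: "?q = r + 1" using q by (metis add.commute le_Suc_ex one_add_one add.assoc)
  show "finite (proj_plane :: ('a ^ 3) set set)" by simp
  have "?q ^ 3 = card (proj_plane :: ('a ^ 3) set set) * (?q - 1) + 1"
    using card_proj_points_in[OF vec.subspace_UNIV, where ?'a = 'a] by (simp add: proj_points_in_UNIV)
  moreover have "?q ^ 3 = (?q^2 + ?q + 1) * (?q - 1) + 1"
    unfolding r by (simp add: power2_eq_square power3_eq_cube algebra_simps)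
  ultimately show "card (proj_plane :: ('a ^ 3) set set) = ?q^2 + ?q + 1" by (metis cancel add_right_cancel)
  show "?q > 0" by simp
  show "card L = ?q + 1" if L: "L \<in> proj_lines" for L :: "('a ^ 3) set set"
  proof -
    obtain S where S: "vec.subspace S" "vec.dim S = 2" "L = proj_points_in S" using L by (auto simp: proj_lines_def)
    have "?q ^ 2 = card L * (?q - 1) + 1" using card_proj_points_in card_dim_2 S by metis
    moreover have "?q ^ 2 = (?q + 1) * (?q - 1) + 1"
      unfolding r by (simp add: power2_eq_square algebra_simps)
    ultimately show ?thesis by (metis cancel add_right_cancel)
  qed
  show "\<exists>L\<in>proj_lines. x \<in> L \<and> y \<in> L" if "x \<in> proj_plane" "y \<in> proj_plane" "x \<noteq> y" for x y :: "('a ^ 3) set"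
    using ex_proj_line lifts_nonempty that by metis
  show "card (L \<inter> M) = 1" if "L \<in> proj_lines" "M \<in> proj_lines" "L \<noteq> M" for L M :: "('a ^ 3) set set"
    using that card_proj_line_Int by (auto simp: proj_lines_def)
qed (auto simp: proj_lines_def proj_points_in_def)

section \<open>Projective independence as non-collinearity\<close>

lemma proj_indep_iff:
  fixes p r s :: "('a::{field,finite} ^ 3) set"
  assumes "p \<in> proj_plane" "r \<in> proj_plane" "s \<in> proj_plane"
  shows "proj_indep p r s \<longleftrightarrow> finite_projective_plane.indep proj_lines p r s"
proof -
  interpret finite_projective_plane "proj_plane :: ('a ^ 3) set set" proj_lines "CARD('a)"
    by (rule finite_projective_plane_proj_plane)
  show ?thesis
  proof
    assume ind: "proj_indep p r s"
    show "indep p r s" unfolding indep_def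
    proof
      assume "\<exists>L\<in>proj_lines. p \<in> L \<and> r \<in> L \<and> s \<in> L"
      then obtain S where S: "vec.subspace S" "vec.dim S = 2" "p \<subseteq> S" "r \<subseteq> S" "s \<subseteq> S"
        by (auto simp: proj_lines_def proj_points_in_def)
      \<comment> \<open>Points have lifts, so the universal quantifiers in \<open>proj_indep\<close>
        are not vacuous; three independent lifts cannot fit into a plane.\<close>
      obtain x y z where xyz: "x \<in> lifts p" "y \<in> lifts r" "z \<in> lifts s"
        using lifts_nonempty assms by meson
      have "distinct [x, y, z]" "vec.independent {x, y, z}" using ind xyz by (auto simp: proj_indep_def)
      moreover have "{x, y, z} \<subseteq> S" using xyz S by (auto simp: lifts_def)
      ultimately have "card {x, y, z} \<le> vec.dim S" by (metis vec.independent_card_le_dim)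
      then show False using \<open>distinct [x, y, z]\<close> S by simp
    qed
  next
    assume ind: "indep p r s"
    \<comment> \<open>Distinctness makes the lifts of \<open>r\<close> and \<open>s\<close> span the
      plane of their line; a lift of \<open>p\<close> outside it extends them to an independent
      triple.\<close>
    then have "r \<noteq> s" using not_indep_same assms by blast
    show "proj_indep p r s" unfolding proj_indep_def
    proof (intro ballI)
      fix x y z assume xyz: "x \<in> lifts p" "y \<in> lifts r" "z \<in> lifts s"
      note L = ex_proj_line[OF assms(2,3) \<open>r \<noteq> s\<close> xyz(2,3)]
      have "p \<notin> proj_points_in (vec.span {y, z})" using L ind by (auto simp: indep_def)
      then have "x \<notin> vec.span {y, z}"
        using proj_plane_subset_iff[OF assms(1) xyz(1) vec.subspace_span] assms by (simp add: proj_points_in_def)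
      then show "distinct [x, y, z] \<and> vec.independent {x, y, z}"
        using independent_lifts[OF assms(2,3) \<open>r \<noteq> s\<close> xyz(2,3)]
        by (auto simp: vec.independent_insert vec.span_base)
    qed
  qed
qed

lemma C3_eq_cyclic_tuples:
  "(C3 n :: ('a::{field,finite} ^ 3) set list set) =
     cyclic_tuples proj_plane (finite_projective_plane.indep proj_lines) n"
proof -
  have "proj_indep (vs ! i) (vs ! ((i + 1) mod n)) (vs ! ((i + 2) mod n)) \<longleftrightarrow>
      finite_projective_plane.indep proj_lines (vs ! i) (vs ! ((i + 1) mod n)) (vs ! ((i + 2) mod n))"
    if "length vs = n" "set vs \<subseteq> proj_plane" "i < n" for vs :: "('a ^ 3) set list" and i
    using that by (intro proj_indep_iff) (auto simp: subset_iff)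
  then show ?thesis unfolding C3_def cyclic_tuples_def by blast
qed

theorem theorem3p3:
  fixes n q :: nat
  assumes "n \<ge> 3"
    and "CARD('a::{field,finite}) = q"
  shows "int (card (C3 n :: ('a ^ 3) set list set)) =
    (if \<not> [n = 0] (mod 3)
     then int q ^ (2 * n) - int q ^ (n + 2) - int q ^ (n + 1) + int q ^ 3
     else int q ^ (2 * n) + 2 * int q ^ (n + 2) + 2 * int q ^ (n + 1) + int q ^ 3)"
proof -
  interpret finite_projective_plane "proj_plane :: ('a ^ 3) set set" proj_lines q
    using finite_projective_plane_proj_plane[where ?'a = 'a] assms(2) by simp
  show ?thesis
    using card_cyclic_tuples_indep[of n] assms(1)
    by (simp add: C3_eq_cyclic_tuples cong_0_iff)
qed

end
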